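(* Let $n\in\mathbb{N}$, and let $c_1,\dots,c_n$, $\lambda_1,\dots,\lambda_n$, $w$, $P$, $M_1$, $M_2$ and $\bar X_s$ be as in the context. Consider the system for a symmetric matrix function $A=(A_{i,j})_{1\le i,j\le n}$ and a vector function $B=(B_i)_{1\le i\le n}$ of $s\in[0,P]$ and a constant $H_n\in\mathbb{R}$, where $D_i=\sum_{j=1}^{n}c_jA_{i,j}$: $$0=\frac{\partial A_{i,j}}{\partial s}-(\lambda_i+\lambda_j)A_{i,j}-\frac1w D_iD_j+1\qquad(1\le i,j\le n,\ 0\le s\le P),$$ $$0=\frac{\partial B_i}{\partial s}-\lambda_iB_i-\frac{D_i}{w}\sum_{j=1}^{n}c_jB_j+M_1D_i-\bar X_s\qquad(1\le i\le n,\ 0\le s\le P),$$ $$H_n=\frac1P\int_0^P\left\{-\frac{1}{2w}\Big(\sum_{i=1}^{n}c_iB_i\Big)^2+\frac12M_2\sum_{i=1}^{n}c_iA_{i,i}+M_1\sum_{i=1}^{n}c_iB_i+\frac12(\bar X_s)^2\right\}\mathrm{d}s.$$ This system is uniquely solved by a smooth, positive semi-definite, $n\times n$ matrix function $A$ having the period $P$, a smooth $n$-dimensional vector function $B$ having the period $P$, and a constant $H_n$; that is, there exists exactly one triple $(A,B,H_n)$ with these properties satisfying the three equations.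
   Context: Measures. $\nu(\mathrm{d}z)=a_\nu z^{-1-\alpha_\nu}e^{-b_\nu z^{p_\nu}}\mathrm{d}z$ on $(0,+\infty)$ with $a_\nu>0$, $b_\nu>0$, $\alpha_\nu<1$, $p_\nu>0$, and $M_k=\int_0^{+\infty}z^k\nu(\mathrm{d}z)$ (finite, $k\in\mathbb{N}$). $\pi(\mathrm{d}\lambda)=\frac{1}{\Gamma(\alpha_\pi)}\frac{\lambda^{\alpha_\pi-1}}{B_\pi^{\alpha_\pi}}e^{-\lambda/B_\pi}\mathrm{d}\lambda$ on $(0,+\infty)$ with $\alpha_\pi>1$, $B_\pi>0$ (here $\Gamma(\cdot)$ is the Gamma function). Discretization. Fix $\beta\in(0,1)$, $\bar\eta>0$; put $\eta_{n,0}=0$, $\eta_{n,i}=\bar\eta\,i/n^\beta$ ($1\le i\le n$), and $$c_i=\int_{\eta_{n,i-1}}^{\eta_{n,i}}\pi(\mathrm{d}\lambda)>0,\qquad\lambda_i=\frac1{c_i}\int_{\eta_{n,i-1}}^{\eta_{n,i}}\lambda\,\pi(\mathrm{d}\lambda)\in(\eta_{n,i-1},\eta_{n,i}),\qquad1\le i\le n,$$ so that $0<\lambda_1<\lambda_2<\dots<\lambda_n$. Other data. $w>0$ is a constant weight, $P>0$ is a period, $\underline X\ge0$ is a constant, $\hat X_s>\underline X$ is a smooth bounded function of time $s$ with period $P$, and $\bar X_s=\hat X_s-\underline X>0$. "Having the period $P$" means extending to a smooth $P$-periodic function of $s\in\mathbb{R}$; "positive semi-definite" means positive semi-definite (and symmetric)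 at every $s$. *)

theory Defs
  imports "HOL-Analysis.Analysis"
begin

definition nu_measure :: "real \<Rightarrow> real \<Rightarrow> real \<Rightarrow> real \<Rightarrow> real measure" where
  "nu_measure a \<alpha> b p =
     density lborel (\<lambda>z. ennreal (indicator {0<..} z * (a * z powr (-1 - \<alpha>) * exp (- b * z powr p))))"

definition nu_moment :: "real \<Rightarrow> real \<Rightarrow> real \<Rightarrow> real \<Rightarrow> nat \<Rightarrow> real" where
  "nu_moment a \<alpha> b p k = (LINT z|nu_measure a \<alpha> b p. z ^ k)"

definition pi_measure :: "real \<Rightarrow> real \<Rightarrow> real measure" where
  "pi_measure \<alpha> B =
     density lborel (\<lambda>l. ennreal (indicator {0<..} l *
       (1 / Gamma \<alpha> * (l powr (\<alpha> - 1) / B powr \<alpha>) * exp (- l / B))))"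

definition grid :: "real \<Rightarrow> real \<Rightarrow> nat \<Rightarrow> nat \<Rightarrow> real" where
  "grid eta_bar \<beta> n i = eta_bar * real i / real n powr \<beta>"

text \<open>The cells are indexed by \<open>i = 1, \<dots>, n\<close>; cell \<open>i\<close> is the interval between grid points
  \<open>i - 1\<close> and \<open>i\<close>. As the measure has no atoms, the choice of half-open intervals is immaterial.\<close>

definition cell :: "real \<Rightarrow> real \<Rightarrow> nat \<Rightarrow> nat \<Rightarrow> real set" where
  "cell eta_bar \<beta> n i = {grid eta_bar \<beta> n (i - 1)<..grid eta_bar \<beta> n i}"

definition cell_weight :: "real measure \<Rightarrow> real \<Rightarrow> real \<Rightarrow> nat \<Rightarrow> nat \<Rightarrow> real" where
  "cell_weight \<mu> eta_bar \<beta> n i = (LINT l:cell eta_bar \<beta> n i|\<mu>. 1)"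

definition cell_mean :: "real measure \<Rightarrow> real \<Rightarrow> real \<Rightarrow> nat \<Rightarrow> nat \<Rightarrow> real" where
  "cell_mean \<mu> eta_bar \<beta> n i =
     1 / cell_weight \<mu> eta_bar \<beta> n i * (LINT l:cell eta_bar \<beta> n i|\<mu>. l)"

text \<open>Infinitely differentiable on the whole real line.\<close>

definition smooth :: "(real \<Rightarrow> 'a::real_normed_vector) \<Rightarrow> bool" where
  "smooth f \<longleftrightarrow>
     (\<forall>k. ((\<lambda>g s. vector_derivative g (at s)) ^^ k) f differentiable_on UNIV)"

definition pos_semidefinite :: "real ^ 'n ^ 'n \<Rightarrow> bool" where
  "pos_semidefinite M \<longleftrightarrow> transpose M = M \<and> (\<forall>x. 0 \<le> x \<bullet> (M *v x))"

definition weighted_row_sum :: "('n::finite \<Rightarrow> real) \<Rightarrow> real ^ 'n ^ 'n \<Rightarrow> 'n \<Rightarrow> real" where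
  "weighted_row_sum c M i = (\<Sum>j\<in>UNIV. c j * M $ i $ j)"

definition A_equation ::
  "('n::finite \<Rightarrow> real) \<Rightarrow> ('n \<Rightarrow> real) \<Rightarrow> real \<Rightarrow> real \<Rightarrow> (real \<Rightarrow> real ^ 'n ^ 'n) \<Rightarrow> bool" where
  "A_equation c l w P A \<longleftrightarrow>
     (\<forall>i j. \<forall>s\<in>{0..P}.
        0 = deriv (\<lambda>t. A t $ i $ j) s - (l i + l j) * A s $ i $ j
            - 1 / w * weighted_row_sum c (A s) i * weighted_row_sum c (A s) j + 1)"

definition B_equation ::
  "('n::finite \<Rightarrow> real) \<Rightarrow> ('n \<Rightarrow> real) \<Rightarrow> real \<Rightarrow> real \<Rightarrow> real \<Rightarrow> (real \<Rightarrow> real) \<Rightarrow>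
   (real \<Rightarrow> real ^ 'n ^ 'n) \<Rightarrow> (real \<Rightarrow> real ^ 'n) \<Rightarrow> bool" where
  "B_equation c l w P M1 Xbar A B \<longleftrightarrow>
     (\<forall>i. \<forall>s\<in>{0..P}.
        0 = deriv (\<lambda>t. B t $ i) s - l i * B s $ i
            - weighted_row_sum c (A s) i / w * (\<Sum>j\<in>UNIV. c j * B s $ j)
            + M1 * weighted_row_sum c (A s) i - Xbar s)"

definition H_equation ::
  "('n::finite \<Rightarrow> real) \<Rightarrow> real \<Rightarrow> real \<Rightarrow> real \<Rightarrow> real \<Rightarrow> (real \<Rightarrow> real) \<Rightarrow>
   (real \<Rightarrow> real ^ 'n ^ 'n) \<Rightarrow> (real \<Rightarrow> real ^ 'n) \<Rightarrow> real \<Rightarrow> bool" where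
  "H_equation c w P M1 M2 Xbar A B H \<longleftrightarrow>
     H = 1 / P * integral {0..P} (\<lambda>s.
           - 1 / (2 * w) * (\<Sum>i\<in>UNIV. c i * B s $ i)\<^sup>2
           + 1 / 2 * M2 * (\<Sum>i\<in>UNIV. c i * A s $ i $ i)
           + M1 * (\<Sum>i\<in>UNIV. c i * B s $ i)
           + 1 / 2 * (Xbar s)\<^sup>2)"

end

theory Submission
  imports Defs
begin

text \<open>
  The system decouples: first \<open>A\<close>, then \<open>B\<close>, and \<open>H\<close> is an explicit integral of the two.  The
  coefficients of the equation for \<open>A\<close> do not depend on time, so its periodic solution is sought
  among the constants.  The structure of the data (a diagonal drift and a rank-one quadratic
  term with positive entries) reduces every step to a finite-dimensional or a scalar problem.

  Existence of \<open>A\<close>.  For constant \<open>A\<close> the equation reads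
  \<open>(l i + l j) * A i j = 1 - D i * D j / w\<close>, so \<open>A\<close> is determined by its weighted row sums
  \<open>D\<close>.  Summing against \<open>c\<close> gives
  \<open>D i * (1 + (\<Sum>j. c j * D j / (l i + l j)) / w) = (\<Sum>j. c j / (l i + l j))\<close>, a fixed-point
  problem for a continuous self-map of a box, which Brouwer's theorem solves
  (\<open>row_sum_fixed_point\<close>).

  Normalization.  With \<open>t i = sqrt (D i / c i)\<close> put \<open>X i j = A i j / (t i * t j)\<close>,
  \<open>m i = c i * t i / sqrt w\<close> and \<open>q i = 1 / t i\<close>.  Writing \<open>L\<close> for the diagonal matrix with
  entries \<open>l i\<close>, the equation becomes \<open>L X + X L = q q\<^sup>T - m m\<^sup>T\<close> together with \<open>X m = m\<close>, and
  the linearized drift becomes the \<^emph>\<open>symmetric\<close> positive definite matrix \<open>L + m m\<^sup>T\<close>.  An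
  eigenvector of \<open>X\<close> for a negative eigenvalue would be orthogonal to \<open>m\<close>, which contradicts
  the equation; so \<open>X\<close> is positive semidefinite.  Its diagonal is then nonnegative, which gives
  \<open>m \<le> q\<close> and hence nonnegative entries; as \<open>X\<close> fixes the positive vector \<open>m\<close>, a
  Perron-type estimate gives \<open>X \<le> 1\<close> as quadratic forms.

  Uniqueness of \<open>A\<close>.  Let \<open>Y\<close> be another periodic positive semidefinite solution in normalized
  form and \<open>E = Y - X\<close>.  If \<open>E\<close> is not identically zero, let \<open>\<bar>x \<bullet> E(s) x\<bar>\<close> be maximal over one
  period and the unit sphere.  There \<open>E(s) x = \<mu> x\<close> with \<open>\<mu> \<noteq> 0\<close>, and the time derivative of
  \<open>x \<bullet> E x\<close> vanishes.  By the equations that derivative is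
  \<open>\<mu> * (2 * (x \<bullet> L x) + (2 + \<mu>) * (m \<bullet> x)\<^sup>2)\<close>, and \<open>\<mu> \<ge> -1\<close> because \<open>Y \<ge> 0\<close> and \<open>X \<le> 1\<close>: a
  contradiction (\<open>normalized_equilibrium.periodic_solution_unique\<close>).

  The vector \<open>B\<close>.  After normalization its equation is \<open>b' = (L + m m\<^sup>T) b + g\<close> with periodic
  \<open>g\<close>.  The eigenvectors of the symmetric matrix span the space, so existence reduces to scalar
  equations with an explicit periodic solution (\<open>linear_periodic_solution\<close>).  The difference of
  two solutions vanishes because its squared norm is stationary where it is maximal
  (\<open>linear_periodic_solution_zero\<close>).

  The measure theory enters only through \<open>c i > 0\<close> and \<open>l i > 0\<close>.
\<close>

section \<open>Eigenvectors of self-adjoint maps\<close>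

text \<open>
  First-order optimality: moving from \<open>x\<close> a small distance \<open>e\<close> in the direction of the residual
  \<open>z = f x - \<mu> x\<close> changes \<open>f y \<bullet> y - \<mu> * (y \<bullet> y)\<close> by \<open>2 * e * (z \<bullet> z)\<close> up to second order.  This
  cannot be positive, so \<open>z = 0\<close>.  The invariant subspace \<open>W\<close> makes the fact usable on orthogonal
  complements.
\<close>

lemma selfadjoint_maximizer_is_eigenvector:
  fixes f :: "'a::real_inner \<Rightarrow> 'a"
  assumes lin: "linear f" and sa: "\<And>x y. f x \<bullet> y = x \<bullet> f y"
    and W: "subspace W" "f ` W \<subseteq> W" and x: "x \<in> W"
    and eq: "f x \<bullet> x = \<mu> * (x \<bullet> x)"
    and max: "\<And>y. y \<in> W \<Longrightarrow> f y \<bullet> y \<le> \<mu> * (y \<bullet> y)"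
  shows "f x = \<mu> *\<^sub>R x"
proof -
  define z where "z = f x - \<mu> *\<^sub>R x"
  define K where "K = \<mu> * (z \<bullet> z) - f z \<bullet> z"
  have zW: "z \<in> W"
    using W x by (auto simp: z_def subspace_diff subspace_scale)
  have ineq: "2 * e * (z \<bullet> z) \<le> e\<^sup>2 * K" for e
  proof -
    have "x + e *\<^sub>R z \<in> W"
      using W x zW by (simp add: subspace_add subspace_scale)
    from max[OF this] have "f x \<bullet> x + 2 * e * (f x \<bullet> z) + e\<^sup>2 * (f z \<bullet> z)
        \<le> \<mu> * (x \<bullet> x + 2 * e * (x \<bullet> z) + e\<^sup>2 * (z \<bullet> z))"
      using sa[of z x]
      by (simp add: linear_add[OF lin] linear_scale[OF lin] inner_simps power2_eq_square
          algebra_simps inner_commute)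
    moreover have "f x \<bullet> z = z \<bullet> z + \<mu> * (x \<bullet> z)"
      by (metis z_def inner_add_left inner_scaleR_left diff_add_cancel)
    ultimately show ?thesis
      unfolding K_def using eq by (simp add: algebra_simps)
  qed
  \<comment> \<open>Adding the inequalities for \<open>e = 1\<close> and \<open>e = -1\<close> cancels the linear term.\<close>
  have "K \<ge> 0" using ineq[of 1] ineq[of "-1"] by simp
  have "z \<bullet> z \<le> 0"
  proof (rule ccontr)
    assume "\<not> z \<bullet> z \<le> 0"
    then have pos: "z \<bullet> z > 0" by (rule not_le_imp_less)
    define e where "e = (z \<bullet> z) / (K + 1)"
    have "e > 0" using pos \<open>K \<ge> 0\<close> by (simp add: e_def)
    then have "2 * (z \<bullet> z) \<le> e * K"
      using ineq[of e] by (simp add: power2_eq_square)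
    also have "\<dots> \<le> e * (K + 1)" using \<open>e > 0\<close> by simp
    also have "\<dots> = z \<bullet> z" using \<open>K \<ge> 0\<close> by (simp add: e_def)
    finally show False using pos by simp
  qed
  then have "z = 0" by (metis inner_gt_zero_iff not_le)
  then show ?thesis by (simp add: z_def)
qed

lemma selfadjoint_has_max_eigenvector:
  fixes f :: "'a::euclidean_space \<Rightarrow> 'a"
  assumes lin: "linear f" and sa: "\<And>x y. f x \<bullet> y = x \<bullet> f y"
    and W: "subspace W" "f ` W \<subseteq> W" "W \<noteq> {0}"
  obtains x \<mu> where "x \<in> W" "norm x = 1" "f x = \<mu> *\<^sub>R x"
    "\<And>y. y \<in> W \<Longrightarrow> f y \<bullet> y \<le> \<mu> * (y \<bullet> y)"
proof -
  have W0: "0 \<in> W" using W(1) by (rule subspace_0)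
  then obtain v where v: "v \<in> W" "v \<noteq> 0" using W(3) by blast
  have comp: "compact (W \<inter> sphere 0 1)"
    by (simp add: closed_Int_compact closed_subspace W(1))
  have "(1 / norm v) *\<^sub>R v \<in> W \<inter> sphere 0 1"
    using v W(1) by (simp add: subspace_scale)
  then have ne: "W \<inter> sphere 0 1 \<noteq> {}" by blast
  have cont: "continuous_on (W \<inter> sphere 0 1) (\<lambda>x. f x \<bullet> x)"
    by (intro continuous_on_inner continuous_on_id linear_continuous_on)
      (simp add: lin linear_conv_bounded_linear[symmetric])
  obtain x where x: "x \<in> W \<inter> sphere 0 1"
    and xmax: "\<And>y. y \<in> W \<inter> sphere 0 1 \<Longrightarrow> f y \<bullet> y \<le> f x \<bullet> x"
    using continuous_attains_sup[OF comp ne cont] by blast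
  have max: "f y \<bullet> y \<le> (f x \<bullet> x) * (y \<bullet> y)" if y: "y \<in> W" for y
  proof (cases "y = 0")
    case False
    have "(1 / norm y) *\<^sub>R y \<in> W \<inter> sphere 0 1"
      using y False W(1) by (simp add: subspace_scale)
    from xmax[OF this] have "(f y \<bullet> y) / (norm y)\<^sup>2 \<le> f x \<bullet> x"
      by (simp add: linear_scale[OF lin] power2_eq_square)
    then show ?thesis using False by (simp add: divide_le_eq power2_norm_eq_inner)
  qed (simp add: linear_0[OF lin])
  have nx: "norm x = 1" using x by simp
  then have "x \<bullet> x = 1" by (simp add: norm_eq_1)
  then have "f x = (f x \<bullet> x) *\<^sub>R x"
    using x by (intro selfadjoint_maximizer_is_eigenvector[OF lin sa W(1,2) _ _ max]) auto
  then show thesis using that[of x "f x \<bullet> x"] x nx max by blast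
qed

text \<open>
  The form of the spectral theorem used below: the orthogonal complement of the eigenvectors is
  invariant, so if it were nontrivial it would contain an eigenvector itself.
\<close>

lemma selfadjoint_eigenvectors_span:
  fixes f :: "'a::euclidean_space \<Rightarrow> 'a"
  assumes lin: "linear f" and sa: "\<And>x y. f x \<bullet> y = x \<bullet> f y"
  shows "span {x. \<exists>\<mu>. f x = \<mu> *\<^sub>R x} = UNIV"
proof (rule ccontr)
  define V where "V = {x. \<exists>\<mu>. f x = \<mu> *\<^sub>R x}"
  define W where "W = {y. \<forall>x\<in>V. x \<bullet> y = 0}"
  assume "span {x. \<exists>\<mu>. f x = \<mu> *\<^sub>R x} \<noteq> UNIV"
  then have "span V \<subset> UNIV" by (auto simp: V_def)
  then obtain a where a: "a \<noteq> 0" "\<And>x. x \<in> span V \<Longrightarrow> a \<bullet> x = 0"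
    using span_not_UNIV_orthogonal by blast
  have aW: "a \<in> W" using a(2) by (auto simp: W_def inner_commute span_base)
  have sub: "subspace W"
    by (auto simp: W_def subspace_def inner_simps)
  have inv: "f ` W \<subseteq> W"
  proof safe
    fix y assume y: "y \<in> W"
    have "x \<bullet> f y = 0" if x: "x \<in> V" for x
    proof -
      obtain \<mu> where "f x = \<mu> *\<^sub>R x" using x unfolding V_def by blast
      moreover have "x \<bullet> y = 0" using y x by (auto simp: W_def)
      ultimately show ?thesis using sa[of x y] by simp
    qed
    then show "f y \<in> W" by (simp add: W_def)
  qed
  have ne: "W \<noteq> {0}" using aW a(1) by blast
  obtain x \<mu> where x: "x \<in> W" "norm x = 1" "f x = \<mu> *\<^sub>R x"
    using selfadjoint_has_max_eigenvector[OF lin sa sub inv ne] by blast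
  from x(3) have "x \<in> V" unfolding V_def by blast
  then have "x \<bullet> x = 0" using x(1) unfolding W_def by blast
  then show False using x(2) by simp
qed

section \<open>Smooth functions\<close>

text \<open>
  Coinduction for smoothness: a class of functions whose members have their derivatives in the
  class again consists of smooth functions.  It spares formulas for higher derivatives.
\<close>

lemma smooth_coinduct:
  fixes f :: "real \<Rightarrow> 'a::real_normed_vector"
  assumes "Q f"
    and deriv: "\<And>g. Q g \<Longrightarrow> \<exists>g'. (\<forall>s. (g has_vector_derivative g' s) (at s)) \<and> Q g'"
  shows "smooth f"
proof -
  have step: "g differentiable_on UNIV \<and> Q (\<lambda>s. vector_derivative g (at s))" if Qg: "Q g" for g
  proof -
    obtain g' where g': "\<And>s. (g has_vector_derivative g' s) (at s)" "Q g'"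
      using deriv[OF Qg] by blast
    have "(\<lambda>s. vector_derivative g (at s)) = g'"
      using g'(1) by (auto intro: vector_derivative_at)
    moreover have "g differentiable_on UNIV"
      using g'(1) by (auto simp: differentiable_on_def has_vector_derivative_def
          intro: differentiableI)
    ultimately show ?thesis using g'(2) by simp
  qed
  have "Q (((\<lambda>g s. vector_derivative g (at s)) ^^ k) f)" for k
    by (induction k) (use assms(1) step in auto)
  then show ?thesis using step by (auto simp: smooth_def)
qed

lemma smooth_has_derivative:
  assumes "smooth f"
  obtains f' where "smooth f'" "\<And>s. (f has_vector_derivative f' s) (at s)"
proof
  show "smooth (\<lambda>s. vector_derivative f (at s))"
    using assms unfolding smooth_def
    by (metis (no_types, lifting) comp_apply funpow_Suc_right)
  have "f differentiable_on UNIV"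
    using assms unfolding smooth_def by (metis funpow_0)
  then show "(f has_vector_derivative vector_derivative f (at s)) (at s)" for s
    by (simp add: differentiable_on_def vector_derivative_works)
qed

lemma smooth_const: "smooth (\<lambda>s. a)"
proof (rule smooth_coinduct[where Q = "\<lambda>g. \<exists>a. g = (\<lambda>s. a)"])
  fix g :: "real \<Rightarrow> 'a" assume "\<exists>a. g = (\<lambda>s. a)"
  then show "\<exists>g'. (\<forall>s. (g has_vector_derivative g' s) (at s)) \<and> (\<exists>a. g' = (\<lambda>s. a))"
    by (intro exI[of _ "\<lambda>s. 0"]) auto
qed auto

lemma smooth_add:
  assumes "smooth f" "smooth g"
  shows "smooth (\<lambda>s. f s + g s)"
proof (rule smooth_coinduct[where Q = "\<lambda>h. \<exists>f g. smooth f \<and> smooth g \<and> h = (\<lambda>s. f s + g s)"])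
  fix h :: "real \<Rightarrow> 'a"
  assume "\<exists>f g. smooth f \<and> smooth g \<and> h = (\<lambda>s. f s + g s)"
  then obtain f g where h: "smooth f" "smooth g" "h = (\<lambda>s. f s + g s)" by blast
  obtain f' where f': "smooth f'" "\<And>s. (f has_vector_derivative f' s) (at s)"
    using smooth_has_derivative[OF h(1)] by blast
  obtain g' where g': "smooth g'" "\<And>s. (g has_vector_derivative g' s) (at s)"
    using smooth_has_derivative[OF h(2)] by blast
  show "\<exists>h'. (\<forall>s. (h has_vector_derivative h' s) (at s)) \<and>
      (\<exists>f g. smooth f \<and> smooth g \<and> h' = (\<lambda>s. f s + g s))"
    unfolding h(3) using f' g'
    by (intro exI[of _ "\<lambda>s. f' s + g' s"]) (auto intro: has_vector_derivative_add)
qed (use assms in blast)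

lemma smooth_bounded_linear:
  fixes f :: "real \<Rightarrow> 'a::real_normed_vector" and T :: "'a \<Rightarrow> 'b::real_normed_vector"
  assumes T: "bounded_linear T" and f: "smooth f"
  shows "smooth (\<lambda>s. T (f s))"
proof (rule smooth_coinduct[where Q = "\<lambda>h. \<exists>f. smooth f \<and> h = (\<lambda>s. T (f s))"])
  fix h :: "real \<Rightarrow> 'b"
  assume "\<exists>f. smooth f \<and> h = (\<lambda>s. T (f s))"
  then obtain f where h: "smooth f" "h = (\<lambda>s. T (f s))" by blast
  obtain f' where f': "smooth f'" "\<And>s. (f has_vector_derivative f' s) (at s)"
    using smooth_has_derivative[OF h(1)] by blast
  show "\<exists>h'. (\<forall>s. (h has_vector_derivative h' s) (at s)) \<and>
      (\<exists>f. smooth f \<and> h' = (\<lambda>s. T (f s)))"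
    unfolding h(2) using f'
    by (intro exI[of _ "\<lambda>s. T (f' s)"])
      (auto intro: bounded_linear.has_vector_derivative[OF T])
qed (use f in blast)

text \<open>
  Differentiating \<open>a * y + g\<close> and substituting the equation gives an expression of the same shape,
  so this class of functions is closed under differentiation.
\<close>

lemma smooth_linear_ode_solution:
  fixes y g :: "real \<Rightarrow> real"
  assumes g: "smooth g"
    and ode: "\<And>s. (y has_real_derivative \<mu> * y s + g s) (at s)"
  shows "smooth y"
proof (rule smooth_coinduct[where Q = "\<lambda>h. \<exists>a g. smooth g \<and> h = (\<lambda>s. a * y s + g s)"])
  show "\<exists>a g. smooth g \<and> y = (\<lambda>s. a * y s + g s)"
    by (intro exI[of _ 1] exI[of _ "\<lambda>s. 0"]) (simp add: smooth_const)
next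
  fix h :: "real \<Rightarrow> real"
  assume "\<exists>a g. smooth g \<and> h = (\<lambda>s. a * y s + g s)"
  then obtain a k where h: "smooth k" "h = (\<lambda>s. a * y s + k s)" by blast
  obtain k' where k': "smooth k'" "\<And>s. (k has_vector_derivative k' s) (at s)"
    using smooth_has_derivative[OF h(1)] by blast
  have "smooth (\<lambda>s. a * g s + k' s)"
    using g k'(1) by (intro smooth_add smooth_bounded_linear[OF bounded_linear_mult_right])
  moreover have "(h has_vector_derivative (a * \<mu>) * y s + (a * g s + k' s)) (at s)" for s
    unfolding h(2) using ode[of s] k'(2)[of s]
    by (auto simp: has_real_derivative_iff_has_vector_derivative[symmetric] algebra_simps
        intro!: derivative_eq_intros)
  ultimately show "\<exists>h'. (\<forall>s. (h has_vector_derivative h' s) (at s)) \<and>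
      (\<exists>a g. smooth g \<and> h' = (\<lambda>s. a * y s + g s))"
    by (intro exI[of _ "\<lambda>s. (a * \<mu>) * y s + (a * g s + k' s)"]) blast
qed

section \<open>Periodic solutions of linear equations\<close>

lemma periodic_value_in_period:
  fixes f :: "real \<Rightarrow> 'a"
  assumes "periodic_fun_simple f P" "P > 0"
  shows "\<exists>s\<in>{0..P}. f s = f t"
proof -
  interpret periodic_fun_simple f P by fact
  define k where "k = \<lfloor>t / P\<rfloor>"
  have "of_int k \<le> t / P" "t / P \<le> of_int k + 1"
    unfolding k_def by (rule of_int_floor_le real_of_int_floor_add_one_ge)+
  then have k: "of_int k * P \<le> t" "t \<le> (of_int k + 1) * P"
    using assms(2) by (simp_all add: pos_le_divide_eq pos_divide_le_eq)
  have "f (t - of_int k * P) = f t"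
    by (rule minus_of_int)
  moreover have "t - of_int k * P \<in> {0..P}"
    using k by (simp add: algebra_simps)
  ultimately show ?thesis by blast
qed

text \<open>
  Variation of constants; the free constant is adjusted so that \<open>y P = y 0\<close>, which is possible
  because \<open>exp (\<mu> * P) \<noteq> 1\<close>.  Then \<open>y (s + P)\<close> and \<open>y s\<close> solve the same equation with the same
  initial value and therefore agree.
\<close>

lemma scalar_periodic_solution:
  fixes g :: "real \<Rightarrow> real"
  assumes \<mu>: "\<mu> \<noteq> 0" and P: "P > 0" and g: "smooth g" "periodic_fun_simple g P"
  obtains y where "smooth y" "periodic_fun_simple y P"
    "\<And>s. (y has_real_derivative \<mu> * y s + g s) (at s)"
proof -
  have gc: "isCont g s" for s
  proof -
    obtain g' where "\<And>s. (g has_vector_derivative g' s) (at s)"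
      using smooth_has_derivative[OF g(1)] by blast
    then show ?thesis by (rule has_vector_derivative_continuous)
  qed
  obtain G where G: "\<And>s. (G has_vector_derivative exp (- \<mu> * s) * g s) (at s)"
  proof -
    have "isCont (\<lambda>s. exp (- \<mu> * s) * g s) s" for s
      by (intro continuous_intros gc)
    then have "\<exists>F. \<forall>x. -\<infinity> < ereal x \<longrightarrow> ereal x < \<infinity> \<longrightarrow>
        (F has_vector_derivative exp (- \<mu> * x) * g x) (at x)"
      by (intro einterval_antiderivative) simp_all
    then have "\<exists>F. \<forall>x. (F has_vector_derivative exp (- \<mu> * x) * g x) (at x)"
      by simp
    then show thesis using that by blast
  qed
  \<comment> \<open>The value of the free constant for which \<open>y P = y 0\<close>.\<close>
  define K where "K = (exp (\<mu> * P) * G P - G 0) / (1 - exp (\<mu> * P))"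
  have ne: "exp (\<mu> * P) \<noteq> 1" using \<mu> P by simp
  define y where "y s = exp (\<mu> * s) * (K + G s)" for s
  have ode: "(y has_real_derivative \<mu> * y s + g s) (at s)" for s
  proof -
    have "(G has_real_derivative exp (- \<mu> * s) * g s) (at s)"
      using G[of s] by (simp add: has_real_derivative_iff_has_vector_derivative)
    then have "(y has_real_derivative
        \<mu> * exp (\<mu> * s) * (K + G s) + exp (\<mu> * s) * (exp (- \<mu> * s) * g s)) (at s)"
      unfolding y_def by (auto intro!: derivative_eq_intros)
    moreover have "exp (\<mu> * s) * (exp (- \<mu> * s) * g s) = g s"
      by (simp add: exp_minus)
    ultimately show ?thesis unfolding y_def by (metis mult.assoc)
  qed
  have y0: "y P = y 0"
  proof -
    have "K * (1 - exp (\<mu> * P)) = exp (\<mu> * P) * G P - G 0"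
      using ne by (simp add: K_def)
    then show ?thesis by (simp add: y_def algebra_simps)
  qed
  have "periodic_fun_simple y P"
  proof
    fix s
    have "((\<lambda>s. y (s + P)) has_real_derivative \<mu> * y (s + P) + g s) (at s)" for s
      using DERIV_shift[THEN iffD1, OF ode[of "s + P"]] periodic_fun_simple.plus_period[OF g(2)]
      by simp
    then have d: "((\<lambda>s. exp (- \<mu> * s) * (y (s + P) - y s)) has_real_derivative 0) (at s)" for s
      by (auto intro!: derivative_eq_intros ode simp: algebra_simps)
    have "exp (- \<mu> * s) * (y (s + P) - y s) = exp (- \<mu> * 0) * (y (0 + P) - y 0)"
      using DERIV_isconst_all[of "\<lambda>s. exp (- \<mu> * s) * (y (s + P) - y s)"] d by blast
    then show "y (s + P) = y s" using y0 by simp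
  qed
  then show thesis using that ode smooth_linear_ode_solution[OF g(1) ode] by blast
qed

text \<open>
  The vectors \<open>u\<close> such that every forcing term \<open>k s *\<^sub>R u\<close> with scalar \<open>k\<close> admits a periodic
  solution form a subspace.  It contains every eigenvector of \<open>f\<close>, by the scalar case, and hence
  is the whole space.  A general forcing term is then split into its coordinates.
\<close>

lemma linear_periodic_solution:
  fixes f :: "'a::euclidean_space \<Rightarrow> 'a" and g :: "real \<Rightarrow> 'a"
  assumes lin: "linear f" and sa: "\<And>x y. f x \<bullet> y = x \<bullet> f y"
    and nonsingular: "\<And>x. x \<noteq> 0 \<Longrightarrow> f x \<noteq> 0"
    and P: "P > 0" and g: "smooth g" "periodic_fun_simple g P"
  obtains b where "smooth b" "periodic_fun_simple b P"
    "\<And>s. (b has_vector_derivative f (b s) + g s) (at s)"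
proof -
  define sol where "sol h b \<longleftrightarrow> smooth b \<and> periodic_fun_simple b P \<and>
      (\<forall>s. (b has_vector_derivative f (b s) + h s) (at s))" for h b
  define V where "V = {u. \<forall>k::real \<Rightarrow> real. smooth k \<longrightarrow> periodic_fun_simple k P \<longrightarrow>
      (\<exists>b. sol (\<lambda>s. k s *\<^sub>R u) b)}"
  have sol0: "sol (\<lambda>s. 0) (\<lambda>s. 0)"
    using linear_0[OF lin] by (auto simp: sol_def smooth_const periodic_fun_simple_def)
  have sol_add: "sol (\<lambda>s. h s + h' s) (\<lambda>s. b s + b' s)" if "sol h b" "sol h' b'" for h h' b b'
  proof -
    have "((\<lambda>s. b s + b' s) has_vector_derivative (f (b s) + h s) + (f (b' s) + h' s)) (at s)" for s
      using that by (intro has_vector_derivative_add) (auto simp: sol_def)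
    then show ?thesis
      using that
      by (auto simp: sol_def smooth_add periodic_fun_simple_def linear_add[OF lin] algebra_simps)
  qed
  have sol_scale: "sol (\<lambda>s. a *\<^sub>R h s) (\<lambda>s. a *\<^sub>R b s)" if "sol h b" for a h b
  proof -
    have "((\<lambda>s. a *\<^sub>R b s) has_vector_derivative a *\<^sub>R (f (b s) + h s)) (at s)" for s
      using that
      by (intro bounded_linear.has_vector_derivative[OF bounded_linear_scaleR_right])
        (auto simp: sol_def)
    then show ?thesis
      using that smooth_bounded_linear[OF bounded_linear_scaleR_right, of b a]
      by (auto simp: sol_def periodic_fun_simple_def linear_scale[OF lin] algebra_simps)
  qed
  have subV: "subspace V"
  proof (rule subspaceI)
    show "0 \<in> V" using sol0 by (auto simp: V_def)
  next
    fix u v assume "u \<in> V" "v \<in> V"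
    then show "u + v \<in> V"
      unfolding V_def by (simp add: scaleR_add_right) (metis sol_add)
  next
    fix a u assume u: "u \<in> V"
    show "a *\<^sub>R u \<in> V"
      unfolding V_def
    proof safe
      fix k :: "real \<Rightarrow> real" assume "smooth k" "periodic_fun_simple k P"
      then obtain b where "sol (\<lambda>s. k s *\<^sub>R u) b" using u by (auto simp: V_def)
      from sol_scale[OF this, of a] show "\<exists>b. sol (\<lambda>s. k s *\<^sub>R a *\<^sub>R u) b"
        by (auto simp: mult.commute)
    qed
  qed
  have "{x. \<exists>\<mu>. f x = \<mu> *\<^sub>R x} \<subseteq> V"
  proof safe
    fix x \<mu> assume x: "f x = \<mu> *\<^sub>R x"
    show "x \<in> V"
    proof (cases "x = 0")
      case True
      then show ?thesis using subV by (simp add: subspace_0)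
    next
      case False
      have "\<mu> \<noteq> 0" using nonsingular[OF False] x by auto
      show ?thesis
        unfolding V_def
      proof safe
        fix k :: "real \<Rightarrow> real" assume k: "smooth k" "periodic_fun_simple k P"
        obtain y where y: "smooth y" "periodic_fun_simple y P"
          "\<And>s. (y has_real_derivative \<mu> * y s + k s) (at s)"
          using scalar_periodic_solution[OF \<open>\<mu> \<noteq> 0\<close> P k] by blast
        have "((\<lambda>s. y s *\<^sub>R x) has_vector_derivative (\<mu> * y s + k s) *\<^sub>R x) (at s)" for s
          using y(3)[of s]
          by (intro bounded_linear.has_vector_derivative[OF bounded_linear_scaleR_left])
            (simp add: has_real_derivative_iff_has_vector_derivative)
        then have "sol (\<lambda>s. k s *\<^sub>R x) (\<lambda>s. y s *\<^sub>R x)"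
          using y smooth_bounded_linear[OF bounded_linear_scaleR_left, of y x]
          by (auto simp: sol_def periodic_fun_simple_def linear_scale[OF lin] x algebra_simps)
        then show "\<exists>b. sol (\<lambda>s. k s *\<^sub>R x) b" by blast
      qed
    qed
  qed
  then have "V = UNIV"
    using selfadjoint_eigenvectors_span[OF lin sa] span_minimal[OF _ subV] by blast
  then have "\<exists>b. sol (\<lambda>s. (g s \<bullet> i) *\<^sub>R i) b" for i
  proof -
    have "smooth (\<lambda>s. g s \<bullet> i)"
      using smooth_bounded_linear[OF bounded_linear_inner_left g(1)] .
    moreover have "periodic_fun_simple (\<lambda>s. g s \<bullet> i) P"
      using g(2) by (simp add: periodic_fun_simple_def)
    moreover have "i \<in> V" using \<open>V = UNIV\<close> by simp
    ultimately show ?thesis unfolding V_def by blast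
  qed
  then obtain b where b: "\<And>i. sol (\<lambda>s. (g s \<bullet> i) *\<^sub>R i) (b i)" by metis
  have "sol (\<lambda>s. \<Sum>i\<in>F. (g s \<bullet> i) *\<^sub>R i) (\<lambda>s. \<Sum>i\<in>F. b i s)" if "finite F" for F
    using that
  proof (induction F)
    case empty
    then show ?case using sol0 by simp
  next
    case (insert i F)
    then show ?case using sol_add[OF b insert.IH] by simp
  qed
  from this[OF finite_Basis] have "sol g (\<lambda>s. \<Sum>i\<in>Basis. b i s)"
    by (simp add: euclidean_representation)
  then show thesis using that by (auto simp: sol_def)
qed

text \<open>
  At a maximum of the periodic function \<open>b s \<bullet> b s\<close> its derivative \<open>2 * (f (b s) \<bullet> b s)\<close> is zero,
  so \<open>b s\<close>, the largest value in norm, is zero.  Periodicity makes the maximum over one period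
  global, so that it may lie at an endpoint.
\<close>

lemma linear_periodic_solution_zero:
  fixes f :: "'a::real_inner \<Rightarrow> 'a"
  assumes pos: "\<And>x. x \<noteq> 0 \<Longrightarrow> f x \<bullet> x > 0"
    and P: "P > 0" and b: "periodic_fun_simple b P"
    and ode: "\<And>s. s \<in> {0..P} \<Longrightarrow> (b has_vector_derivative f (b s)) (at s)"
  shows "b t = 0"
proof -
  have d: "((\<lambda>s. b s \<bullet> b s) has_real_derivative 2 * (f (b s) \<bullet> b s)) (at s)"
    if "s \<in> {0..P}" for s
    using bounded_bilinear.has_vector_derivative[OF bounded_bilinear_inner ode[OF that] ode[OF that]]
    by (simp add: has_real_derivative_iff_has_vector_derivative inner_commute)
  have "continuous_on {0..P} (\<lambda>s. b s \<bullet> b s)"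
    by (intro continuous_at_imp_continuous_on ballI) (rule DERIV_isCont[OF d])
  moreover have "{0..P} \<noteq> {}" using P by simp
  ultimately obtain s where s: "s \<in> {0..P}" "\<And>r. r \<in> {0..P} \<Longrightarrow> b r \<bullet> b r \<le> b s \<bullet> b s"
    using continuous_attains_sup[OF compact_Icc] by blast
  have max: "b r \<bullet> b r \<le> b s \<bullet> b s" for r
  proof -
    obtain r' where "r' \<in> {0..P}" "b r' = b r"
      using periodic_value_in_period[OF b P, of r] by blast
    then show ?thesis using s(2)[of r'] by simp
  qed
  have "2 * (f (b s) \<bullet> b s) = 0"
    by (rule DERIV_local_max[OF d[OF s(1)], of 1]) (use max in simp_all)
  then have "b s = 0" using pos[of "b s"] by (metis less_irrefl mult_eq_0_iff zero_neq_numeral)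
  then show ?thesis using max[of t] by (metis inner_eq_zero_iff inner_ge_zero inner_zero_left order_antisym)
qed


section \<open>Extremal eigenpairs of periodic symmetric matrices\<close>

lemma symmetric_matrix_selfadjoint:
  fixes M :: "real ^ 'n ^ 'n"
  assumes "transpose M = M"
  shows "(M *v x) \<bullet> y = x \<bullet> (M *v y)"
  by (metis assms dot_lmul_matrix vector_transpose_matrix)

lemma symmetric_form_zero:
  fixes M :: "real ^ 'n ^ 'n"
  assumes sym: "transpose M = M" and zero: "\<And>x. x \<bullet> (M *v x) = 0"
  shows "M = 0"
proof -
  have "x \<bullet> (M *v y) = 0" for x y
  proof -
    have "(x + y) \<bullet> (M *v (x + y)) = x \<bullet> (M *v x) + y \<bullet> (M *v y) + 2 * (x \<bullet> (M *v y))"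
      using symmetric_matrix_selfadjoint[OF sym, of x y]
      by (simp add: matrix_vector_right_distrib inner_simps inner_commute)
    then show ?thesis by (simp add: zero)
  qed
  then have "M *v y = 0" for y by (metis inner_eq_zero_iff)
  then show ?thesis by (simp add: matrix_eq)
qed

text \<open>
  The device behind uniqueness.  Maximizing \<open>\<bar>x \<bullet> E s x\<bar>\<close> over a period and the unit sphere gives
  a pair \<open>(s, x)\<close> at which \<open>x\<close> is an eigenvector of \<open>E s\<close> and at which, for fixed \<open>x\<close>, the form
  \<open>x \<bullet> E t x\<close> is extremal in time as well.  The absolute value handles both signs of \<open>\<mu>\<close> at
  once.
\<close>

lemma extremal_eigenpair:
  fixes E :: "real \<Rightarrow> real ^ 'n ^ 'n"
  assumes P: "P > 0" and per: "periodic_fun_simple E P"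
    and cont: "continuous_on {0..P} E"
    and sym: "\<And>s. transpose (E s) = E s"
    and nz: "E r \<noteq> 0"
  obtains s x \<mu> where "s \<in> {0..P}" "norm x = 1" "\<mu> \<noteq> 0" "E s *v x = \<mu> *\<^sub>R x"
    "(\<forall>t. x \<bullet> (E t *v x) \<le> x \<bullet> (E s *v x)) \<or> (\<forall>t. x \<bullet> (E s *v x) \<le> x \<bullet> (E t *v x))"
proof -
  define S where "S = {0..P} \<times> (sphere 0 1 :: (real ^ 'n) set)"
  have comp: "compact S" by (simp add: S_def compact_Times)
  have contq: "continuous_on S (\<lambda>p. \<bar>snd p \<bullet> (E (fst p) *v snd p)\<bar>)"
  proof -
    have contE: "continuous_on S (\<lambda>p. E (fst p))"
      by (rule continuous_on_compose2[OF cont continuous_on_fst]) (auto simp: S_def continuous_on_id)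
    show ?thesis
      unfolding inner_vec_def matrix_vector_mult_def
      by (simp, intro continuous_intros contE)
  qed
  have ne: "S \<noteq> {}"
    using P by (auto simp: S_def intro: exI[of _ 0])
  obtain p where p: "p \<in> S"
    and pmax: "\<And>p'. p' \<in> S \<Longrightarrow> \<bar>snd p' \<bullet> (E (fst p') *v snd p')\<bar> \<le> \<bar>snd p \<bullet> (E (fst p) *v snd p)\<bar>"
    using continuous_attains_sup[OF comp ne contq] by blast
  define s where "s = fst p"
  define x where "x = snd p"
  define K where "K = x \<bullet> (E s *v x)"
  have s: "s \<in> {0..P}" and nx: "norm x = 1" using p by (auto simp: S_def s_def x_def)
  then have xx: "x \<bullet> x = 1" by (simp add: norm_eq_1)
  have bound: "\<bar>y \<bullet> (E t *v y)\<bar> \<le> \<bar>K\<bar> * (y \<bullet> y)" for t y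
  proof (cases "y = 0")
    case False
    obtain t' where t': "t' \<in> {0..P}" "E t' = E t"
      using periodic_value_in_period[OF per P, of t] by blast
    have "(t', (1 / norm y) *\<^sub>R y) \<in> S" using False t' by (simp add: S_def)
    from pmax[OF this] have "\<bar>y \<bullet> (E t *v y)\<bar> / (norm y)\<^sup>2 \<le> \<bar>K\<bar>"
      by (simp add: t'(2) K_def s_def x_def matrix_vector_mult_scaleR power2_eq_square abs_mult)
    then show ?thesis using False by (simp add: divide_le_eq power2_norm_eq_inner)
  qed simp
  have K: "K \<noteq> 0"
  proof
    assume "K = 0"
    then have "E r = 0" using bound[of _ r] by (intro symmetric_form_zero[OF sym]) simp
    then show False using nz by simp
  qed
  \<comment> \<open>Multiplication by the sign of \<open>K\<close> turns the extremum of the form of \<open>E s\<close> into a maximum.\<close>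
  define \<sigma> where "\<sigma> = sgn K"
  have \<sigma>: "\<sigma> * \<sigma> = 1" "\<sigma> * K = \<bar>K\<bar>" "\<bar>\<sigma>\<bar> = 1"
    using K by (auto simp: \<sigma>_def sgn_if)
  define f where "f y = \<sigma> *\<^sub>R (E s *v y)" for y
  have "f x = \<bar>K\<bar> *\<^sub>R x"
  proof (rule selfadjoint_maximizer_is_eigenvector[where W = UNIV])
    show "linear f"
      by (rule linearI) (simp_all add: f_def matrix_vector_right_distrib matrix_vector_mult_scaleR algebra_simps)
    show "f a \<bullet> b = a \<bullet> f b" for a b
      by (simp add: f_def symmetric_matrix_selfadjoint[OF sym])
    show "f x \<bullet> x = \<bar>K\<bar> * (x \<bullet> x)"
      unfolding \<sigma>(2)[symmetric] by (simp add: f_def xx K_def inner_commute)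
    show "f y \<bullet> y \<le> \<bar>K\<bar> * (y \<bullet> y)" for y
    proof -
      have "f y \<bullet> y \<le> \<bar>\<sigma> * (y \<bullet> (E s *v y))\<bar>" by (simp add: f_def inner_commute)
      also have "\<dots> = \<bar>y \<bullet> (E s *v y)\<bar>" by (simp add: abs_mult \<sigma>(3))
      finally show ?thesis using bound[of y s] by linarith
    qed
  qed auto
  then have "\<sigma> *\<^sub>R f x = (\<sigma> * \<bar>K\<bar>) *\<^sub>R x" by simp
  moreover have "\<sigma> * \<bar>K\<bar> = K" by (metis \<sigma>(1,2) mult.assoc mult_1)
  ultimately have eig: "E s *v x = K *\<^sub>R x" by (simp add: f_def \<sigma>(1))
  have "\<bar>x \<bullet> (E t *v x)\<bar> \<le> \<bar>K\<bar>" for t using bound[of x t] by (simp add: xx)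
  then have "(\<forall>t. x \<bullet> (E t *v x) \<le> K) \<or> (\<forall>t. K \<le> x \<bullet> (E t *v x))"
  proof (cases "K \<ge> 0")
    case True
    then show ?thesis using \<open>\<And>t. \<bar>x \<bullet> (E t *v x)\<bar> \<le> \<bar>K\<bar>\<close> by (metis abs_le_D1 abs_of_nonneg)
  next
    case False
    have "K \<le> x \<bullet> (E t *v x)" for t
      using \<open>\<And>t. \<bar>x \<bullet> (E t *v x)\<bar> \<le> \<bar>K\<bar>\<close>[of t] False by linarith
    then show ?thesis by blast
  qed
  then show thesis using that[OF s nx K eig] by (simp add: K_def)
qed

section \<open>The row sums of a constant solution\<close>

text \<open>
  Dividing by the bracket gives \<open>D = F D\<close>, where \<open>F\<close> maps the box of all \<open>D\<close> with
  \<open>0 \<le> D i \<le> (\<Sum>j. c j / (l i + l j))\<close> into itself: the denominator is at least \<open>1\<close> there.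
\<close>

lemma row_sum_fixed_point:
  fixes c l :: "'n::finite \<Rightarrow> real"
  assumes c: "\<And>i. c i > 0" and l: "\<And>i. l i > 0" and w: "w > 0"
  obtains D where "\<And>i. D i > 0"
    "\<And>i. D i * (1 + (\<Sum>j\<in>UNIV. c j * D j / (l i + l j)) / w) = (\<Sum>j\<in>UNIV. c j / (l i + l j))"
proof -
  define K where "K i = (\<Sum>j\<in>UNIV. c j / (l i + l j))" for i
  define S where "S = cbox 0 (\<chi> i. K i)"
  define den where "den D i = 1 + (\<Sum>j\<in>UNIV. c j * D $ j / (l i + l j)) / w" for D :: "real ^ 'n" and i
  define F where "F D = (\<chi> i. K i / den D i)" for D
  have K: "K i > 0" for i
    unfolding K_def using c l by (intro sum_pos) (auto intro!: divide_pos_pos add_pos_pos)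
  have den: "den D i \<ge> 1" if D: "D \<in> S" for D i
  proof -
    have "(\<Sum>j\<in>UNIV. c j * D $ j / (l i + l j)) \<ge> 0"
    proof (rule sum_nonneg)
      fix j
      have "D $ j \<ge> 0" using D by (simp add: S_def mem_box_cart)
      then show "c j * D $ j / (l i + l j) \<ge> 0"
        using c[of j] l[of i] l[of j] by simp
    qed
    then show ?thesis using w by (simp add: den_def)
  qed
  have "continuous_on S F"
    unfolding F_def
  proof (intro continuous_on_vec_lambda continuous_on_divide continuous_on_const ballI)
    show "continuous_on S (\<lambda>D. den D i)" for i
      unfolding den_def divide_inverse by (intro continuous_intros)
    show "den D i \<noteq> 0" if "D \<in> S" for D i using den[OF that, of i] by linarith
  qed
  moreover have "F \<in> S \<rightarrow> S"
  proof
    fix D assume D: "D \<in> S"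
    have "0 \<le> K i / den D i \<and> K i / den D i \<le> K i" for i
      using den[OF D, of i] K[of i] by (simp add: divide_le_eq)
    then show "F D \<in> S" by (simp add: S_def F_def mem_box_cart)
  qed
  moreover have "0 \<in> S" using K by (simp add: S_def mem_box_cart less_imp_le)
  ultimately obtain D where D: "D \<in> S" "F D = D"
    using brouwer[of S F] unfolding S_def by (metis compact_cbox convex_box(1) empty_iff)
  have eq: "D $ i = K i / den D i" for i using D(2) by (metis F_def vec_lambda_beta)
  have dp: "den D i > 0" for i using den[OF D(1), of i] by linarith
  show thesis
  proof
    show "D $ i > 0" for i using K[of i] dp[of i] eq[of i] by simp
    show "D $ i * (1 + (\<Sum>j\<in>UNIV. c j * D $ j / (l i + l j)) / w) = (\<Sum>j\<in>UNIV. c j / (l i + l j))" for i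
      using dp[of i] eq[of i] unfolding den_def[symmetric] K_def[symmetric] by simp
  qed
qed


section \<open>The normalized algebraic Riccati equation\<close>

definition diag_apply :: "('n::finite \<Rightarrow> real) \<Rightarrow> real ^ 'n \<Rightarrow> real ^ 'n" where
  "diag_apply l x = (\<chi> i. l i * x $ i)"

lemma diag_apply_pos:
  assumes l: "\<And>i. l i > 0" and x: "x \<noteq> 0"
  shows "diag_apply l x \<bullet> x > 0"
proof -
  obtain i where "x $ i \<noteq> 0" using x by (auto simp: vec_eq_iff)
  then have "0 < x $ i * x $ i" by (metis not_real_square_gt_zero)
  then have "0 < l i * x $ i * x $ i"
    using l[of i] by (simp only: mult.assoc) (rule mult_pos_pos)
  moreover have "0 \<le> l j * x $ j * x $ j" for j
    using l[of j] by (simp add: mult.assoc)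
  ultimately show ?thesis
    unfolding diag_apply_def inner_vec_def by (auto intro!: sum_pos2[of UNIV i])
qed

text \<open>
  The quadratic form of \<open>L Y + Y L + a a\<^sup>T - b b\<^sup>T\<close>, where \<open>L\<close> is the diagonal matrix with entries
  \<open>l i\<close>.  With \<open>a = Y m\<close> and \<open>b = q\<close> this matrix is the right-hand side of the normalized Riccati
  differential equation.
\<close>

lemma riccati_quadratic_form:
  fixes Y :: "real ^ 'n ^ 'n"
  assumes sym: "transpose Y = Y"
  shows "(\<Sum>i\<in>UNIV. \<Sum>j\<in>UNIV. x $ i * x $ j * ((l i + l j) * Y $ i $ j + a $ i * a $ j - b $ i * b $ j))
    = 2 * (diag_apply l x \<bullet> (Y *v x)) + (a \<bullet> x)\<^sup>2 - (b \<bullet> x)\<^sup>2"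
proof -
  have Yji: "Y $ j $ i = Y $ i $ j" for i j
    by (metis sym transpose_def vec_lambda_beta)
  have sq: "(\<Sum>i\<in>UNIV. \<Sum>j\<in>UNIV. x $ i * x $ j * (d $ i * d $ j)) = (d \<bullet> x)\<^sup>2" for d :: "real ^ 'n"
    by (simp add: inner_vec_def power2_eq_square sum_product mult_ac)
  have row: "(\<Sum>i\<in>UNIV. \<Sum>j\<in>UNIV. x $ i * x $ j * (l i * Y $ i $ j)) = diag_apply l x \<bullet> (Y *v x)"
    by (simp add: inner_vec_def diag_apply_def matrix_vector_mult_def sum_distrib_left mult_ac)
  have "(\<Sum>i\<in>UNIV. \<Sum>j\<in>UNIV. x $ i * x $ j * (l j * Y $ i $ j))
      = (\<Sum>j\<in>UNIV. \<Sum>i\<in>UNIV. x $ j * x $ i * (l j * Y $ j $ i))"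
    by (subst sum.swap) (simp add: Yji mult_ac)
  then have col: "(\<Sum>i\<in>UNIV. \<Sum>j\<in>UNIV. x $ i * x $ j * (l j * Y $ i $ j)) = diag_apply l x \<bullet> (Y *v x)"
    by (simp add: row)
  have "(\<Sum>i\<in>UNIV. \<Sum>j\<in>UNIV. x $ i * x $ j * ((l i + l j) * Y $ i $ j + a $ i * a $ j - b $ i * b $ j))
    = (\<Sum>i\<in>UNIV. \<Sum>j\<in>UNIV. x $ i * x $ j * (l i * Y $ i $ j)) +
      (\<Sum>i\<in>UNIV. \<Sum>j\<in>UNIV. x $ i * x $ j * (l j * Y $ i $ j)) +
      (\<Sum>i\<in>UNIV. \<Sum>j\<in>UNIV. x $ i * x $ j * (a $ i * a $ j)) -
      (\<Sum>i\<in>UNIV. \<Sum>j\<in>UNIV. x $ i * x $ j * (b $ i * b $ j))"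
    by (simp add: sum.distrib[symmetric] sum_subtractf[symmetric] algebra_simps)
  then show ?thesis by (simp add: row col sq)
qed

text \<open>
  A constant solution after the scaling that symmetrizes the closed-loop drift.  In the original
  variables \<open>X *v m = m\<close> says that the numbers \<open>D i\<close> from which the solution is built are its
  weighted row sums.
\<close>

locale normalized_equilibrium =
  fixes l :: "'n::finite \<Rightarrow> real" and m q :: "real ^ 'n" and X :: "real ^ 'n ^ 'n"
  assumes l_pos: "l i > 0" and m_pos: "m $ i > 0" and q_pos: "q $ i > 0"
    and riccati: "(l i + l j) * X $ i $ j = q $ i * q $ j - m $ i * m $ j"
    and fixes_m: "X *v m = m"
begin

lemma X_commute: "X $ j $ i = X $ i $ j"
  using riccati[of i j] riccati[of j i] l_pos[of i] l_pos[of j]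
  by (metis add.commute add_pos_pos less_irrefl mult.commute mult_cancel_left)

lemma X_symmetric: "transpose X = X"
  by (simp add: vec_eq_iff transpose_def X_commute)

lemma X_adjoint: "(X *v x) \<bullet> y = x \<bullet> (X *v y)"
  by (rule symmetric_matrix_selfadjoint[OF X_symmetric])

text \<open>
  Thus an eigenvector of \<open>X\<close> for an eigenvalue other than \<open>1\<close> is orthogonal to \<open>m\<close>.
\<close>

lemma m_inner_X: "m \<bullet> (X *v x) = m \<bullet> x"
  using X_adjoint[of m x] by (simp add: fixes_m)

lemma X_form: "2 * (diag_apply l x \<bullet> (X *v x)) + (m \<bullet> x)\<^sup>2 - (q \<bullet> x)\<^sup>2 = 0"
  using riccati_quadratic_form[OF X_symmetric, of x l m q] by (simp add: riccati)

text \<open>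
  Take an eigenvector \<open>z\<close> for the least eigenvalue, written \<open>- \<mu>\<close>.  If \<open>\<mu> > 0\<close>, then \<open>z\<close> is
  orthogonal to \<open>m\<close>, and the Riccati equation expresses \<open>(q \<bullet> z)\<^sup>2\<close> as a negative number.
\<close>

lemma X_psd: "0 \<le> x \<bullet> (X *v x)"
proof -
  have lin: "linear (\<lambda>y. - (X *v y))"
    by (rule linearI) (simp_all add: matrix_vector_right_distrib matrix_vector_mult_scaleR)
  have sa: "- (X *v a) \<bullet> b = a \<bullet> - (X *v b)" for a b
    by (simp add: X_adjoint)
  have "axis i 1 \<noteq> (0 :: real ^ 'n)" for i by (simp add: axis_eq_0_iff)
  then have "(UNIV :: (real ^ 'n) set) \<noteq> {0}" by blast
  then obtain z \<mu> where z: "norm z = 1" "- (X *v z) = \<mu> *\<^sub>R z"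
    and max: "\<And>y. - (X *v y) \<bullet> y \<le> \<mu> * (y \<bullet> y)"
    using selfadjoint_has_max_eigenvector[OF lin sa, of UNIV] by auto
  have Xz: "X *v z = (- \<mu>) *\<^sub>R z" using z(2) by (metis minus_equation_iff scaleR_minus_left)
  have "\<mu> \<le> 0"
  proof (rule ccontr)
    assume "\<not> \<mu> \<le> 0"
    then have \<mu>: "\<mu> > 0" by simp
    have "m \<bullet> z = - \<mu> * (m \<bullet> z)" using m_inner_X[of z] by (simp add: Xz)
    then have "(1 + \<mu>) * (m \<bullet> z) = 0" by (simp add: algebra_simps)
    then have "m \<bullet> z = 0" using \<mu> by simp
    then have "(q \<bullet> z)\<^sup>2 = - 2 * \<mu> * (diag_apply l z \<bullet> z)"
      using X_form[of z] by (simp add: Xz)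
    moreover have "z \<noteq> 0" using z(1) by auto
    ultimately have "(q \<bullet> z)\<^sup>2 < 0"
      using diag_apply_pos[OF l_pos, of z] \<mu> by simp
    then show False by (simp add: not_less[symmetric])
  qed
  then have "\<mu> * (x \<bullet> x) \<le> 0" by (simp add: mult_nonpos_nonneg)
  then show ?thesis using max[of x] by (simp add: inner_commute)
qed

text \<open>
  Nonnegativity of the diagonal entries means \<open>m \<le> q\<close> componentwise, and this controls all other
  entries.
\<close>

lemma X_nonneg: "0 \<le> X $ i $ j"
proof -
  have "m $ k \<le> q $ k" for k
  proof -
    have "axis k 1 \<bullet> (X *v axis k 1) = X $ k $ k"
      by (simp add: inner_axis' matrix_vector_mul_component inner_axis)
    then have "0 \<le> X $ k $ k" using X_psd[of "axis k 1"] by simp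
    then have "0 \<le> (l k + l k) * X $ k $ k"
      using l_pos[of k] by (intro mult_nonneg_nonneg) auto
    then have "(m $ k)\<^sup>2 \<le> (q $ k)\<^sup>2" unfolding riccati by (simp add: power2_eq_square)
    then show ?thesis by (rule power2_le_imp_le) (rule less_imp_le[OF q_pos])
  qed
  then have "m $ i * m $ j \<le> q $ i * q $ j"
    using m_pos q_pos by (intro mult_mono) (auto intro: less_imp_le)
  then have "0 \<le> (l i + l j) * X $ i $ j" unfolding riccati by simp
  moreover have "0 < l i + l j" using l_pos[of i] l_pos[of j] by simp
  ultimately show ?thesis by (simp only: zero_le_mult_iff) auto
qed

text \<open>
  A Perron-type estimate: a symmetric matrix with nonnegative entries that fixes a positive vector
  has norm at most \<open>1\<close>.  In the coordinates \<open>u i = x i / m i\<close> it follows from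
  \<open>2 * u i * u j \<le> (u i)\<^sup>2 + (u j)\<^sup>2\<close>.
\<close>

lemma X_le_identity: "x \<bullet> (X *v x) \<le> x \<bullet> x"
proof -
  define u where "u i = x $ i / m $ i" for i
  have x: "x $ i = m $ i * u i" for i using m_pos[of i] by (simp add: u_def)
  define w where "w i j = X $ i $ j * m $ i * m $ j" for i j
  have wsum: "(\<Sum>j\<in>UNIV. w i j) = m $ i * m $ i" for i
  proof -
    have "(\<Sum>j\<in>UNIV. w i j) = m $ i * (X *v m) $ i"
      by (simp add: w_def matrix_vector_mult_def sum_distrib_left mult_ac)
    then show ?thesis by (simp add: fixes_m)
  qed
  have diag: "(\<Sum>i\<in>UNIV. \<Sum>j\<in>UNIV. w i j * (u i)\<^sup>2) = x \<bullet> x"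
    by (simp only: sum_distrib_right[symmetric] wsum)
      (simp add: inner_vec_def x power2_eq_square mult_ac)
  have diag': "(\<Sum>i\<in>UNIV. \<Sum>j\<in>UNIV. w i j * (u j)\<^sup>2) = x \<bullet> x"
    by (subst sum.swap, subst diag[symmetric]) (simp add: w_def X_commute mult_ac)
  have "x \<bullet> (X *v x) = (\<Sum>i\<in>UNIV. \<Sum>j\<in>UNIV. w i j * (u i * u j))"
    by (simp add: inner_vec_def matrix_vector_mult_def sum_distrib_left x w_def mult_ac)
  also have "\<dots> \<le> (\<Sum>i\<in>UNIV. \<Sum>j\<in>UNIV. w i j * (((u i)\<^sup>2 + (u j)\<^sup>2) / 2))"
  proof (intro sum_mono mult_left_mono)
    fix i j
    show "u i * u j \<le> ((u i)\<^sup>2 + (u j)\<^sup>2) / 2"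
      using sum_squares_bound[of "u i" "u j"] by simp
    show "0 \<le> w i j"
      using X_nonneg[of i j] m_pos[of i] m_pos[of j] by (simp add: w_def)
  qed
  also have "\<dots> = ((\<Sum>i\<in>UNIV. \<Sum>j\<in>UNIV. w i j * (u i)\<^sup>2) + (\<Sum>i\<in>UNIV. \<Sum>j\<in>UNIV. w i j * (u j)\<^sup>2)) / 2"
    by (simp add: sum.distrib[symmetric] sum_divide_distrib algebra_simps add_divide_distrib)
  also have "\<dots> = x \<bullet> x" by (simp add: diag diag')
  finally show ?thesis .
qed

text \<open>
  At an extremal eigenpair of \<open>E = Y - X\<close> the time derivative of \<open>x \<bullet> E x\<close> is zero, while the
  equations give it the value \<open>\<mu> * (2 * (x \<bullet> L x) + (2 + \<mu>) * (m \<bullet> x)\<^sup>2)\<close>.  The hypothesis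
  \<open>Y \<ge> 0\<close> enters through \<open>\<mu> \<ge> -1\<close>; it excludes, for instance, the second, negative
  equilibrium that the equation has in dimension one.
\<close>

theorem periodic_solution_unique:
  fixes Y :: "real \<Rightarrow> real ^ 'n ^ 'n"
  assumes P: "P > 0" and per: "periodic_fun_simple Y P"
    and cont: "continuous_on {0..P} Y"
    and psd: "\<And>s. pos_semidefinite (Y s)"
    and ode: "\<And>s i j. s \<in> {0..P} \<Longrightarrow> ((\<lambda>t. Y t $ i $ j) has_real_derivative
      (l i + l j) * Y s $ i $ j + (Y s *v m) $ i * (Y s *v m) $ j - q $ i * q $ j) (at s)"
  shows "Y r = X"
proof (rule ccontr)
  assume "Y r \<noteq> X"
  define E where "E t = Y t - X" for t
  have Ysym: "transpose (Y t) = Y t" for t using psd by (simp add: pos_semidefinite_def)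
  have Ev: "E t *v x = Y t *v x - X *v x" for t x
    by (simp add: E_def matrix_vector_mult_diff_rdistrib)
  have "transpose (E t) = E t" for t
    using Ysym[of t] X_symmetric by (simp add: E_def transpose_def vec_eq_iff)
  moreover have "periodic_fun_simple E P"
    using per by (simp add: periodic_fun_simple_def E_def)
  moreover have "continuous_on {0..P} E"
    unfolding E_def by (intro continuous_intros cont)
  moreover have "E r \<noteq> 0" using \<open>Y r \<noteq> X\<close> by (simp add: E_def)
  ultimately obtain s x \<mu> where s: "s \<in> {0..P}" and x: "norm x = 1" and \<mu>: "\<mu> \<noteq> 0"
    and eig: "E s *v x = \<mu> *\<^sub>R x"
    and extremum: "(\<forall>t. x \<bullet> (E t *v x) \<le> x \<bullet> (E s *v x)) \<or> (\<forall>t. x \<bullet> (E s *v x) \<le> x \<bullet> (E t *v x))"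
    using extremal_eigenpair[OF P, of E r] by blast
  have xx: "x \<bullet> x = 1" and x0: "x \<noteq> 0" using x by (auto simp: norm_eq_1)
  define h where "h t = x \<bullet> (E t *v x)" for t
  define h' where "h' = 2 * (diag_apply l x \<bullet> (Y s *v x)) + ((Y s *v m) \<bullet> x)\<^sup>2 - (q \<bullet> x)\<^sup>2"
  have dsum: "((\<lambda>t. \<Sum>i\<in>UNIV. \<Sum>j\<in>UNIV. x $ i * x $ j * Y t $ i $ j) has_real_derivative
    (\<Sum>i\<in>UNIV. \<Sum>j\<in>UNIV. x $ i * x $ j *
      ((l i + l j) * Y s $ i $ j + (Y s *v m) $ i * (Y s *v m) $ j - q $ i * q $ j))) (at s)"
    by (intro DERIV_sum DERIV_cmult ode s)
  have h_eq: "h t = (\<Sum>i\<in>UNIV. \<Sum>j\<in>UNIV. x $ i * x $ j * Y t $ i $ j) - x \<bullet> (X *v x)" for t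
    by (simp add: h_def Ev inner_diff_right)
      (simp add: inner_vec_def matrix_vector_mult_def sum_distrib_left mult_ac)
  have h_fun: "h = (\<lambda>t. (\<Sum>i\<in>UNIV. \<Sum>j\<in>UNIV. x $ i * x $ j * Y t $ i $ j) - x \<bullet> (X *v x))"
    by (rule ext) (rule h_eq)
  have dh: "(h has_real_derivative h') (at s)"
    using DERIV_diff[OF dsum DERIV_const[of "x \<bullet> (X *v x)"]]
    unfolding riccati_quadratic_form[OF Ysym] h'_def h_fun by (simp only: diff_0_right)
  have "h' = 0"
    using extremum
  proof
    assume "\<forall>t. x \<bullet> (E t *v x) \<le> x \<bullet> (E s *v x)"
    then show ?thesis
      by (intro DERIV_local_max[OF dh, of 1]) (auto simp: h_def)
  next
    assume "\<forall>t. x \<bullet> (E s *v x) \<le> x \<bullet> (E t *v x)"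
    then show ?thesis
      by (intro DERIV_local_min[OF dh, of 1]) (auto simp: h_def)
  qed
  have Yx: "Y s *v x = X *v x + \<mu> *\<^sub>R x" using eig by (simp add: Ev algebra_simps)
  have "(Y s *v m) \<bullet> x = (1 + \<mu>) * (m \<bullet> x)"
    using m_inner_X[of x]
    by (simp add: symmetric_matrix_selfadjoint[OF Ysym] Yx inner_add_right algebra_simps)
  then have h'_eq: "h' = 2 * \<mu> * (diag_apply l x \<bullet> x) + \<mu> * (2 + \<mu>) * (m \<bullet> x)\<^sup>2"
    using X_form[of x]
    by (simp add: h'_def Yx inner_add_right power_mult_distrib power2_eq_square algebra_simps)
  have "- 1 \<le> \<mu>"
  proof -
    have "0 \<le> x \<bullet> (Y s *v x)" using psd[of s] by (simp add: pos_semidefinite_def)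
    also have "\<dots> = x \<bullet> (X *v x) + \<mu>" by (simp add: Yx inner_add_right xx)
    also have "\<dots> \<le> 1 + \<mu>" using X_le_identity[of x] by (simp add: xx)
    finally show ?thesis by simp
  qed
  then have "2 * (diag_apply l x \<bullet> x) + (2 + \<mu>) * (m \<bullet> x)\<^sup>2 > 0"
    using diag_apply_pos[OF l_pos x0] by (intro add_pos_nonneg) auto
  moreover have "h' = \<mu> * (2 * (diag_apply l x \<bullet> x) + (2 + \<mu>) * (m \<bullet> x)\<^sup>2)"
    unfolding h'_eq by (simp add: algebra_simps)
  ultimately show False using \<open>h' = 0\<close> \<mu> by simp
qed

end


section \<open>The original system\<close>

lemma smooth_has_deriv:
  fixes f :: "real \<Rightarrow> real"
  assumes "smooth f"
  shows "(f has_real_derivative deriv f s) (at s)"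
proof -
  obtain f' where "\<And>s. (f has_vector_derivative f' s) (at s)"
    using smooth_has_derivative[OF assms] by blast
  then have "(f has_real_derivative f' s) (at s)"
    by (simp add: has_real_derivative_iff_has_vector_derivative)
  then show ?thesis by (metis DERIV_imp_deriv)
qed

lemma smooth_vec_nth:
  fixes f :: "real \<Rightarrow> 'a::real_normed_vector ^ 'n"
  shows "smooth f \<Longrightarrow> smooth (\<lambda>s. f s $ i)"
  by (rule smooth_bounded_linear[OF bounded_linear_vec_nth])

lemma bounded_linear_diag_apply: "bounded_linear (diag_apply l)"
  by (simp add: linear_conv_bounded_linear[symmetric])
    (rule linearI, simp_all add: diag_apply_def vec_eq_iff algebra_simps)

lemma A_equation_ode:
  assumes "smooth A" "A_equation c l w P A" "s \<in> {0..P}"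
  shows "((\<lambda>t. A t $ i $ j) has_real_derivative (l i + l j) * A s $ i $ j
      + 1 / w * weighted_row_sum c (A s) i * weighted_row_sum c (A s) j - 1) (at s)"
proof -
  have "deriv (\<lambda>t. A t $ i $ j) s = (l i + l j) * A s $ i $ j
      + 1 / w * weighted_row_sum c (A s) i * weighted_row_sum c (A s) j - 1"
  proof -
    have "0 = deriv (\<lambda>t. A t $ i $ j) s - (l i + l j) * A s $ i $ j
        - 1 / w * weighted_row_sum c (A s) i * weighted_row_sum c (A s) j + 1"
      using assms(2,3) unfolding A_equation_def by blast
    then show ?thesis by linarith
  qed
  moreover have "smooth (\<lambda>t. A t $ i $ j)"
    by (intro smooth_vec_nth assms(1))
  ultimately show ?thesis using smooth_has_deriv by metis
qed

lemma B_equation_ode: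
  assumes "smooth B" "B_equation c l w P M1 f A B" "s \<in> {0..P}"
  shows "(B has_vector_derivative (\<chi> i. l i * B s $ i
      + weighted_row_sum c (A s) i / w * (\<Sum>j\<in>UNIV. c j * B s $ j)
      - M1 * weighted_row_sum c (A s) i + f s)) (at s)"
proof -
  obtain B' where B': "\<And>s. (B has_vector_derivative B' s) (at s)"
    using smooth_has_derivative[OF assms(1)] by blast
  have "B' s $ i = l i * B s $ i
      + weighted_row_sum c (A s) i / w * (\<Sum>j\<in>UNIV. c j * B s $ j)
      - M1 * weighted_row_sum c (A s) i + f s" for i
  proof -
    have "((\<lambda>t. B t $ i) has_real_derivative B' s $ i) (at s)"
      using bounded_linear.has_vector_derivative[OF bounded_linear_vec_nth B']
      by (simp add: has_real_derivative_iff_has_vector_derivative)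
    then have "deriv (\<lambda>t. B t $ i) s = B' s $ i" by (rule DERIV_imp_deriv)
    moreover have "0 = deriv (\<lambda>t. B t $ i) s - l i * B s $ i
        - weighted_row_sum c (A s) i / w * (\<Sum>j\<in>UNIV. c j * B s $ j)
        + M1 * weighted_row_sum c (A s) i - f s"
      using assms(2,3) unfolding B_equation_def by blast
    ultimately show ?thesis by linarith
  qed
  then show ?thesis using B'[of s] by (metis (no_types, lifting) vec_lambda_unique)
qed

text \<open>
  The scaling \<open>A i j = t i * t j * X i j\<close>, \<open>B i = t i * b i\<close> carries the system to its normalized
  form.  The choice \<open>t i = sqrt (D i / c i)\<close> makes the drift
  \<open>l i * B i + D i / w * (\<Sum>j. c j * B j)\<close> of the equation for \<open>B\<close> symmetric.
\<close>

theorem riccati_system_unique_solution: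
  fixes c l :: "'n::finite \<Rightarrow> real" and f :: "real \<Rightarrow> real"
  assumes c: "\<And>i. c i > 0" and l: "\<And>i. l i > 0" and w: "w > 0" and P: "P > 0"
    and f: "smooth f" "periodic_fun_simple f P"
  shows "\<exists>!(A :: real \<Rightarrow> real ^ 'n ^ 'n, B :: real \<Rightarrow> real ^ 'n, H :: real).
           smooth A \<and> periodic_fun_simple A P \<and> (\<forall>s. pos_semidefinite (A s)) \<and>
           smooth B \<and> periodic_fun_simple B P \<and>
           A_equation c l w P A \<and>
           B_equation c l w P M1 f A B \<and>
           H_equation c w P M1 M2 f A B H"
proof -
  obtain D where D: "\<And>i. D i > 0"
    and fix_D: "\<And>i. D i * (1 + (\<Sum>j\<in>UNIV. c j * D j / (l i + l j)) / w) = (\<Sum>j\<in>UNIV. c j / (l i + l j))"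
    using row_sum_fixed_point[of c l w, OF c l w] by blast
  define t where "t i = sqrt (D i / c i)" for i
  have t: "t i > 0" for i using D[of i] c[of i] by (simp add: t_def)
  then have t0: "t i \<noteq> 0" for i using less_imp_neq by metis
  have tt: "c i * (t i * t i) = D i" for i
    using D[of i] c[of i] by (simp add: t_def)
  define v where "v = sqrt w"
  have v: "v > 0" and vv: "v * v = w" using w by (simp_all add: v_def)
  have ll: "l i + l j > 0" for i j using l[of i] l[of j] by simp
  define m :: "real ^ 'n" where "m = (\<chi> i. c i * t i / v)"
  define q :: "real ^ 'n" where "q = (\<chi> i. 1 / t i)"
  define X :: "real ^ 'n ^ 'n" where "X = (\<chi> i j. (q $ i * q $ j - m $ i * m $ j) / (l i + l j))"
  have tm: "t i * m $ i = D i / v" for i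
    using tt[of i] by (simp add: m_def mult_ac)
  have qm: "q $ i * m $ i = c i / v" for i
    using t0[of i] by (simp add: m_def q_def)
  have mm: "m $ i * m $ i = c i * D i / w" for i
    using tt[of i] by (simp add: m_def vv[symmetric] mult_ac)
  have qD: "q $ i * D i / v = m $ i" for i
    using t0[of i] by (simp add: q_def m_def tt[symmetric])
  interpret N: normalized_equilibrium l m q X
  proof
    show "l i > 0" "m $ i > 0" "q $ i > 0" for i
      using l[of i] c[of i] t[of i] v by (simp_all add: m_def q_def)
    show "(l i + l j) * X $ i $ j = q $ i * q $ j - m $ i * m $ j" for i j
      using ll[of i j] by (simp add: X_def)
    show "X *v m = m"
    proof (subst vec_eq_iff, intro allI)
      fix i
      define S where "S = (\<Sum>j\<in>UNIV. c j * D j / (l i + l j))"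
      have "(X *v m) $ i = (\<Sum>j\<in>UNIV. (q $ i * (q $ j * m $ j) - m $ i * (m $ j * m $ j)) / (l i + l j))"
        by (simp add: X_def matrix_vector_mult_def algebra_simps diff_divide_distrib)
      also have "\<dots> = (\<Sum>j\<in>UNIV. (q $ i / v) * (c j / (l i + l j)) - (m $ i / w) * (c j * D j / (l i + l j)))"
        by (simp add: qm mm diff_divide_distrib)
      also have "\<dots> = (q $ i / v) * (\<Sum>j\<in>UNIV. c j / (l i + l j)) - (m $ i / w) * S"
        by (simp only: sum_subtractf sum_distrib_left S_def)
      also have "\<dots> = (q $ i * D i / v) * (1 + S / w) - (m $ i / w) * S"
        unfolding S_def fix_D[symmetric] by (simp add: mult_ac)
      also have "\<dots> = m $ i" unfolding qD by (simp add: algebra_simps)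
      finally show "(X *v m) $ i = m $ i" .
    qed
  qed
  define A0 :: "real ^ 'n ^ 'n" where "A0 = (\<chi> i j. t i * t j * X $ i $ j)"
  have row_A0: "weighted_row_sum c A0 i = D i" for i
  proof -
    have "weighted_row_sum c A0 i = t i * v * (X *v m) $ i"
      using v by (simp add: weighted_row_sum_def A0_def matrix_vector_mult_def m_def
          sum_distrib_left mult_ac)
    then show ?thesis using tm[of i] v by (simp add: N.fixes_m mult_ac)
  qed
  have A0_riccati: "(l i + l j) * A0 $ i $ j + 1 / w * D i * D j - 1 = 0" for i j
  proof -
    have "(l i + l j) * A0 $ i $ j = t i * t j * (q $ i * q $ j - m $ i * m $ j)"
      by (simp add: A0_def N.riccati[symmetric] mult_ac)
    also have "\<dots> = (t i * q $ i) * (t j * q $ j) - (t i * m $ i) * (t j * m $ j)"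
      by (simp add: algebra_simps)
    also have "\<dots> = 1 - D i * D j / w"
      using t0 by (simp only: tm) (simp add: q_def vv[symmetric])
    finally show ?thesis by simp
  qed
  have A0_psd: "pos_semidefinite A0"
    unfolding pos_semidefinite_def
  proof (intro conjI allI)
    show "transpose A0 = A0"
      by (simp add: vec_eq_iff transpose_def A0_def N.X_commute mult_ac)
    fix x
    have "x \<bullet> (A0 *v x) = diag_apply t x \<bullet> (X *v diag_apply t x)"
      by (simp add: A0_def inner_vec_def matrix_vector_mult_def diag_apply_def sum_distrib_left mult_ac)
    then show "0 \<le> x \<bullet> (A0 *v x)" by (simp add: N.X_psd)
  qed
  have A_unique: "A = (\<lambda>s. A0)"
    if A: "smooth A" "periodic_fun_simple A P" "\<forall>s. pos_semidefinite (A s)" "A_equation c l w P A" for A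
  proof
    fix s
    define Y :: "real \<Rightarrow> real ^ 'n ^ 'n" where "Y = (\<lambda>s. \<chi> i j. q $ i * q $ j * A s $ i $ j)"
    have YA: "A s $ i $ j = t i * t j * Y s $ i $ j" for s i j
      using t0 by (simp add: Y_def q_def)
    have Ym: "(Y s *v m) $ i = q $ i * weighted_row_sum c (A s) i / v" for s i
      by (simp add: weighted_row_sum_def matrix_vector_mult_def Y_def sum_distrib_left
          sum_divide_distrib) (simp add: m_def q_def t0 mult_ac)
    have "Y s = X"
    proof (rule N.periodic_solution_unique[OF P])
      show "periodic_fun_simple Y P"
        using A(2) by (simp add: periodic_fun_simple_def Y_def)
      have contA: "continuous_on {0..P} (\<lambda>t. A t $ i $ j)" for i j
        using A_equation_ode[OF A(1,4)]
        by (intro continuous_at_imp_continuous_on ballI) (rule DERIV_isCont)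
      show "continuous_on {0..P} Y"
        unfolding Y_def
        by (intro continuous_on_vec_lambda continuous_on_mult_left contA)
      show "pos_semidefinite (Y s)" for s
        unfolding pos_semidefinite_def
      proof (intro conjI allI)
        have "transpose (A s) = A s" using A(3) by (simp add: pos_semidefinite_def)
        then have "A s $ i $ j = A s $ j $ i" for i j by (metis transpose_def vec_lambda_beta)
        then show "transpose (Y s) = Y s"
          by (simp add: vec_eq_iff transpose_def Y_def mult_ac)
        fix x
        have "x \<bullet> (Y s *v x) = diag_apply (($) q) x \<bullet> (A s *v diag_apply (($) q) x)"
          by (simp add: Y_def inner_vec_def matrix_vector_mult_def diag_apply_def sum_distrib_left mult_ac)
        then show "0 \<le> x \<bullet> (Y s *v x)" using A(3) by (simp add: pos_semidefinite_def)
      qed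
      fix s i j assume s: "s \<in> {0..P}"
      have "((\<lambda>t. Y t $ i $ j) has_real_derivative q $ i * q $ j * ((l i + l j) * A s $ i $ j
        + 1 / w * weighted_row_sum c (A s) i * weighted_row_sum c (A s) j - 1)) (at s)"
        unfolding Y_def vec_lambda_beta by (intro DERIV_cmult A_equation_ode[OF A(1,4) s])
      moreover have "q $ i * q $ j * ((l i + l j) * A s $ i $ j
        + 1 / w * weighted_row_sum c (A s) i * weighted_row_sum c (A s) j - 1)
        = (l i + l j) * Y s $ i $ j + (Y s *v m) $ i * (Y s *v m) $ j - q $ i * q $ j"
        unfolding Ym by (simp add: Y_def vv[symmetric] algebra_simps)
      ultimately show "((\<lambda>t. Y t $ i $ j) has_real_derivative
        (l i + l j) * Y s $ i $ j + (Y s *v m) $ i * (Y s *v m) $ j - q $ i * q $ j) (at s)"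
        by simp
    qed
    then show "A s = A0" by (simp add: vec_eq_iff YA A0_def)
  qed
  \<comment> \<open>The drift of \<open>B\<close> in the scaled coordinates.\<close>
  define S where "S x = diag_apply l x + (m \<bullet> x) *\<^sub>R m" for x
  have S_lin: "linear S"
    by (rule linearI) (simp_all add: S_def diag_apply_def vec_eq_iff inner_simps algebra_simps)
  have S_adj: "S x \<bullet> y = x \<bullet> S y" for x y
  proof -
    have "diag_apply l x \<bullet> y = x \<bullet> diag_apply l y"
      by (simp add: diag_apply_def inner_vec_def mult_ac)
    then show ?thesis by (simp add: S_def inner_simps inner_commute mult_ac)
  qed
  have S_pos: "S x \<bullet> x > 0" if "x \<noteq> 0" for x
  proof -
    have "S x \<bullet> x = diag_apply l x \<bullet> x + (m \<bullet> x)\<^sup>2"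
      by (simp add: S_def inner_simps power2_eq_square)
    then show ?thesis using diag_apply_pos[OF l that] by (simp add: add_pos_nonneg)
  qed
  have S_scaled: "t i * S b $ i = l i * (t i * b $ i) + D i / w * (\<Sum>j\<in>UNIV. c j * (t j * b $ j))" for b i
  proof -
    have "(\<Sum>j\<in>UNIV. c j * (t j * b $ j)) = v * (m \<bullet> b)"
      using v by (simp add: m_def inner_vec_def sum_distrib_left mult_ac)
    moreover have "t i * S b $ i = l i * (t i * b $ i) + (m \<bullet> b) * (t i * m $ i)"
      by (simp add: S_def diag_apply_def algebra_simps)
    ultimately show ?thesis using v by (simp add: tm vv[symmetric])
  qed
  define g where "g s = f s *\<^sub>R q + (\<chi> i. - M1 * D i * q $ i)" for s
  have "smooth g"
    unfolding g_def
    by (intro smooth_add smooth_const smooth_bounded_linear[OF bounded_linear_scaleR_left f(1)])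
  moreover have "periodic_fun_simple g P"
    using f(2) by (simp add: periodic_fun_simple_def g_def)
  ultimately obtain b where b: "smooth b" "periodic_fun_simple b P"
    "\<And>s. (b has_vector_derivative S (b s) + g s) (at s)"
    using linear_periodic_solution[OF S_lin S_adj _ P] S_pos by (metis inner_zero_left less_irrefl)
  define B0 where "B0 s = diag_apply t (b s)" for s
  have B0_smooth: "smooth B0"
    unfolding B0_def by (rule smooth_bounded_linear[OF bounded_linear_diag_apply b(1)])
  have B0_per: "periodic_fun_simple B0 P"
    using b(2) by (simp add: periodic_fun_simple_def B0_def)
  have B0_eq: "B_equation c l w P M1 f (\<lambda>s. A0) B0"
    unfolding B_equation_def
  proof (intro allI ballI)
    fix i s
    have "((\<lambda>s. diag_apply t (b s) $ i) has_vector_derivative diag_apply t (S (b s) + g s) $ i) (at s)"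
      by (intro bounded_linear.has_vector_derivative[OF bounded_linear_vec_nth]
          bounded_linear.has_vector_derivative[OF bounded_linear_diag_apply] b(3))
    then have "((\<lambda>s. B0 s $ i) has_real_derivative t i * S (b s) $ i + t i * g s $ i) (at s)"
      by (simp add: B0_def has_real_derivative_iff_has_vector_derivative diag_apply_def algebra_simps)
    then have "deriv (\<lambda>s. B0 s $ i) s = t i * S (b s) $ i + t i * g s $ i"
      by (rule DERIV_imp_deriv)
    moreover have "t i * g s $ i = f s - M1 * D i"
      using t0[of i] by (simp add: g_def q_def algebra_simps)
    ultimately show "0 = deriv (\<lambda>t. B0 t $ i) s - l i * B0 s $ i
            - weighted_row_sum c A0 i / w * (\<Sum>j\<in>UNIV. c j * B0 s $ j)
            + M1 * weighted_row_sum c A0 i - f s"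
      by (simp add: row_A0 S_scaled) (simp add: B0_def diag_apply_def)
  qed
  have B_unique: "B = B0"
    if B: "smooth B" "periodic_fun_simple B P" "B_equation c l w P M1 f (\<lambda>s. A0) B" for B
  proof
    fix r
    define z where "z s = diag_apply (($) q) (B s - B0 s)" for s
    have tz: "t i * z s $ i = B s $ i - B0 s $ i" for s i
      using t0[of i] by (simp add: z_def diag_apply_def q_def)
    have "z r = 0"
    proof (rule linear_periodic_solution_zero[of S, OF S_pos P])
      show "periodic_fun_simple z P"
        using B(2) B0_per by (simp add: periodic_fun_simple_def z_def)
      fix s assume s: "s \<in> {0..P}"
      define R where "R B s = (\<chi> i. l i * B s $ i
        + weighted_row_sum c A0 i / w * (\<Sum>j\<in>UNIV. c j * B s $ j)
        - M1 * weighted_row_sum c A0 i + f s)" for B :: "real \<Rightarrow> real ^ 'n" and s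
      have "(z has_vector_derivative diag_apply (($) q) (R B s - R B0 s)) (at s)"
        unfolding z_def R_def
        by (intro bounded_linear.has_vector_derivative[OF bounded_linear_diag_apply]
            has_vector_derivative_diff B_equation_ode[OF B(1,3) s] B_equation_ode[OF B0_smooth B0_eq s])
      moreover have "diag_apply (($) q) (R B s - R B0 s) = S (z s)"
      proof (subst vec_eq_iff, intro allI)
        fix i
        have "t i * diag_apply (($) q) (R B s - R B0 s) $ i = R B s $ i - R B0 s $ i"
          using t0[of i] by (simp add: diag_apply_def q_def)
        also have "\<dots> = t i * S (z s) $ i"
          unfolding S_scaled tz
          by (simp add: R_def row_A0 right_diff_distrib sum_subtractf)
        finally show "diag_apply (($) q) (R B s - R B0 s) $ i = S (z s) $ i"
          using t0[of i] by simp
      qed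
      ultimately show "(z has_vector_derivative S (z s)) (at s)" by simp
    qed
    then have "B r $ i - B0 r $ i = 0" for i using tz[of i r] by simp
    then show "B r = B0 r" by (simp add: vec_eq_iff)
  qed
  have A0_eq: "A_equation c l w P (\<lambda>s. A0)"
    using A0_riccati by (simp add: A_equation_def row_A0 algebra_simps)
  define H0 where "H0 = 1 / P * integral {0..P} (\<lambda>s.
           - 1 / (2 * w) * (\<Sum>i\<in>UNIV. c i * B0 s $ i)\<^sup>2
           + 1 / 2 * M2 * (\<Sum>i\<in>UNIV. c i * A0 $ i $ i)
           + M1 * (\<Sum>i\<in>UNIV. c i * B0 s $ i)
           + 1 / 2 * (f s)\<^sup>2)"
  have H: "H_equation c w P M1 M2 f (\<lambda>s. A0) B0 H \<longleftrightarrow> H = H0" for H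
    by (simp only: H_equation_def H0_def)
  show ?thesis
  proof (rule ex1I[of _ "(\<lambda>s. A0, B0, H0)"], goal_cases)
    case 1
    show ?case
      using A0_psd A0_eq B0_smooth B0_per B0_eq H
      by (simp add: smooth_const periodic_fun_simple_def)
  next
    case (2 z)
    obtain A B h where z: "z = (A, B, h)" by (cases z)
    have A: "A = (\<lambda>s. A0)" using 2 unfolding z by (auto intro: A_unique)
    have B: "B = B0" using 2 unfolding z A by (auto intro: B_unique)
    show ?case using 2 unfolding z A B by (auto simp: H)
  qed
qed


section \<open>Positivity of the discretized data\<close>

text \<open>
  The condition \<open>\<alpha> > 1\<close> makes the density continuous at \<open>0\<close>, so the integrand is integrable on
  the first cell too; the integral is therefore not the default value \<open>0\<close> of a non-integrable
  function, and it is positive since the integrand is.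
\<close>

lemma set_integral_pi_measure_pos:
  fixes h :: "real \<Rightarrow> real"
  assumes \<alpha>: "\<alpha> > 1" and B: "B > 0" and ab: "0 \<le> a" "a < b"
    and h: "continuous_on UNIV h" "\<And>x. x > 0 \<Longrightarrow> h x > 0"
  shows "0 < (LINT x:{a<..b}|pi_measure \<alpha> B. h x)"
proof -
  define k where "k x = 1 / Gamma \<alpha> * (x powr (\<alpha> - 1) / B powr \<alpha>) * exp (- x / B)" for x
  define F where "F x = indicator {a<..b} x * (k x * h x)" for x :: real
  have k_pos: "k x > 0" if "x > 0" for x
    using that \<alpha> B Gamma_real_pos[of \<alpha>] by (simp add: k_def)
  have [measurable]: "h \<in> borel_measurable borel"
    using h(1) by (rule borel_measurable_continuous_onI)
  have k_meas [measurable]: "k \<in> borel_measurable borel"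
    unfolding k_def by measurable
  have F_pos: "F x > 0" if "x \<in> {a<..b}" for x
    using that ab k_pos[of x] h(2)[of x] by (simp add: F_def)
  have F_nonneg: "F x \<ge> 0" for x
    using F_pos[of x] by (cases "x \<in> {a<..b}") (auto simp: F_def)
  have "pi_measure \<alpha> B = density lborel (\<lambda>x. ennreal (indicator {0<..} x * k x))"
    by (simp add: pi_measure_def k_def)
  moreover have "AE x in lborel. 0 \<le> indicator {0<..} x * k x"
    using k_pos by (intro AE_I2) (auto simp: indicator_def less_imp_le)
  ultimately have "(LINT x:{a<..b}|pi_measure \<alpha> B. h x)
      = (LINT x|lborel. (indicator {0<..} x * k x) *\<^sub>R (indicator {a<..b} x *\<^sub>R h x))"
    unfolding set_lebesgue_integral_def
    by (simp only: ) (rule integral_density, measurable)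
  also have "\<dots> = (LINT x|lborel. F x)"
    using ab by (intro Bochner_Integration.integral_cong) (auto simp: F_def indicator_def)
  finally have eq: "(LINT x:{a<..b}|pi_measure \<alpha> B. h x) = (LINT x|lborel. F x)" .
  have "continuous_on {a..b} (\<lambda>x. k x * h x)"
    unfolding k_def using \<alpha> ab B
    by (intro continuous_intros continuous_on_powr' continuous_on_subset[OF h(1)]) auto
  then have "set_integrable lborel {a..b} (\<lambda>x. k x * h x)"
    by (rule borel_integrable_atLeastAtMost')
  then have "set_integrable lborel {a<..b} (\<lambda>x. k x * h x)"
    by (rule set_integrable_subset) auto
  then have "integrable lborel (\<lambda>x. F x)"
    unfolding F_def by (simp add: set_integrable_def)
  then have int: "integrable lborel F" .
  have "(LINT x|lborel. F x) \<noteq> 0"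
  proof
    assume "(LINT x|lborel. F x) = 0"
    then have "AE x in lborel. F x = 0"
      using integral_nonneg_eq_0_iff_AE[OF int] F_nonneg by simp
    then have "AE x in lborel. \<not> x \<in> {a<..b}"
      by (rule AE_mp) (rule AE_I2, metis F_pos less_irrefl)
    then have "emeasure lborel {x \<in> space lborel. x \<in> {a<..b}} = 0"
      by (rule emeasure_eq_0_AE)
    moreover have "{x \<in> space lborel. x \<in> {a<..b}} = {a<..b}" by auto
    ultimately show False
      using ab(2) emeasure_lborel_Ioc[of a b] by (simp only: ) simp
  qed
  moreover have "(LINT x|lborel. F x) \<ge> 0"
    using F_nonneg by (rule Bochner_Integration.integral_nonneg)
  ultimately show ?thesis unfolding eq by linarith
qed

lemma
  assumes \<alpha>: "\<alpha> > 1" and B: "B > 0" and eta: "eta_bar > 0" and i: "i \<in> {1..n}"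
  shows cell_weight_pos: "0 < cell_weight (pi_measure \<alpha> B) eta_bar \<beta> n i"
    and cell_mean_pos: "0 < cell_mean (pi_measure \<alpha> B) eta_bar \<beta> n i"
proof -
  have "n powr \<beta> > 0" using i by simp
  then have ab: "0 \<le> grid eta_bar \<beta> n (i - 1)" "grid eta_bar \<beta> n (i - 1) < grid eta_bar \<beta> n i"
    using eta i by (auto simp: grid_def intro!: divide_strict_right_mono)
  show c: "0 < cell_weight (pi_measure \<alpha> B) eta_bar \<beta> n i"
    unfolding cell_weight_def cell_def
    by (rule set_integral_pi_measure_pos[OF \<alpha> B ab]) auto
  have "0 < (LINT l:cell eta_bar \<beta> n i|pi_measure \<alpha> B. l)"
    unfolding cell_def
    by (rule set_integral_pi_measure_pos[OF \<alpha> B ab]) (auto intro: continuous_on_id)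
  then show "0 < cell_mean (pi_measure \<alpha> B) eta_bar \<beta> n i"
    using c by (simp add: cell_mean_def)
qed

section \<open>The periodic system of the discretized model\<close>

theorem proposition2:
  fixes n :: nat and idx :: "'n::finite \<Rightarrow> nat"
    and a_nu \<alpha>_nu b_nu p_nu \<alpha>_pi B_pi \<beta> eta_bar w P X_low :: real
    and X_hat X_bar :: "real \<Rightarrow> real"
    and c l :: "'n \<Rightarrow> real" and M1 M2 :: real
  assumes enumeration: "bij_betw idx UNIV {1..n}"
    and nu: "a_nu > 0" "b_nu > 0" "\<alpha>_nu < 1" "p_nu > 0"
    and pi: "\<alpha>_pi > 1" "B_pi > 0"
    and discretization: "0 < \<beta>" "\<beta> < 1" "eta_bar > 0"
    and weight: "w > 0"
    and period: "P > 0"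
    and X_low: "X_low \<ge> 0"
    and X_hat: "\<And>s. X_hat s > X_low" "smooth X_hat" "bounded (range X_hat)"
               "periodic_fun_simple X_hat P"
    and X_bar: "X_bar = (\<lambda>s. X_hat s - X_low)"
    and moments: "M1 = nu_moment a_nu \<alpha>_nu b_nu p_nu 1" "M2 = nu_moment a_nu \<alpha>_nu b_nu p_nu 2"
    and c: "c = (\<lambda>i. cell_weight (pi_measure \<alpha>_pi B_pi) eta_bar \<beta> n (idx i))"
    and l: "l = (\<lambda>i. cell_mean (pi_measure \<alpha>_pi B_pi) eta_bar \<beta> n (idx i))"
  shows "\<exists>!(A :: real \<Rightarrow> real ^ 'n ^ 'n, B :: real \<Rightarrow> real ^ 'n, H :: real).
           smooth A \<and> periodic_fun_simple A P \<and> (\<forall>s. pos_semidefinite (A s)) \<and>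
           smooth B \<and> periodic_fun_simple B P \<and>
           A_equation c l w P A \<and>
           B_equation c l w P M1 X_bar A B \<and>
           H_equation c w P M1 M2 X_bar A B H"
proof -
  have idx: "idx i \<in> {1..n}" for i
    using enumeration by (auto simp: bij_betw_def)
  have "smooth (\<lambda>s. X_hat s + - X_low)"
    by (intro smooth_add smooth_const X_hat(2))
  then have "smooth X_bar" by (simp add: X_bar)
  moreover have "periodic_fun_simple X_bar P"
    using X_hat(4) by (simp add: X_bar periodic_fun_simple_def)
  ultimately show ?thesis
    using cell_weight_pos[OF pi discretization(3) idx] cell_mean_pos[OF pi discretization(3) idx]
    by (intro riccati_system_unique_solution weight period) (simp_all add: c l)
qed

end
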